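(* Let $S$ be an idempotent semiring with operations $\oplus,\odot$, and let $I(S)$ be the set of all closed intervals in $S$. For $\star\in\{\oplus,\odot\}$ and $\mathbf x,\mathbf y\in I(S)$, let $\mathbf x\mathbin{\overline{\star}}\mathbf y$ be the smallest (with respect to inclusion) interval in $S$ containing the set $\mathbf x\star\mathbf y=\{x\star y\mid x\in\mathbf x,\ y\in\mathbf y\}$. Then $I(S)$ is closed with respect to the operations $\overline{\oplus},\overline{\odot}$ (that is, such a smallest interval always exists) and $\{I(S),\overline{\oplus},\overline{\odot}\}$ is an idempotent semiring. Moreover, for all $\mathbf x=[\underline{\mathbf x},\overline{\mathbf x}]$ and $\mathbf y=[\underline{\mathbf y},\overline{\mathbf y}]$ in $I(S)$ and each $\star\in\{\oplus,\odot\}$, $$\mathbf x\mathbin{\overline{\star}}\mathbf y=[\underline{\mathbf x}\star\underline{\mathbf y},\ \overline{\mathbf x}\star\overline{\mathbf y}].$$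
   Context: An idempotent semiring is a set $S$ with two associative binary operations $\oplus$ (addition) and $\odot$ (multiplication) such that $\oplus$ is commutative and idempotent ($x\oplus x=x$ for all $x$), and $\odot$ distributes over $\oplus$ on both sides. No zero or unity is assumed, and $\odot$ need not be commutative. The partial order on $S$ is: $x\preccurlyeq y$ iff $x\oplus y=y$. A (closed) interval in $S$ is a set of the form $\mathbf x=[\underline{\mathbf x},\overline{\mathbf x}]=\{t\in S\mid\underline{\mathbf x}\preccurlyeq t\preccurlyeq\overline{\mathbf x}\}$ with $\underline{\mathbf x},\overline{\mathbf x}\in S$, $\underline{\mathbf x}\preccurlyeq\overline{\mathbf x}$. *)

theory Defs
  imports Main
begin

text \<open>
  Semirings are carrier-based, so that the set of intervals in a semiring can itself be the
  carrier of a semiring.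
\<close>

locale idempotent_semiring =
  fixes S :: "'a set"
    and add :: "'a \<Rightarrow> 'a \<Rightarrow> 'a" (infixl "\<oplus>" 65)
    and mul :: "'a \<Rightarrow> 'a \<Rightarrow> 'a" (infixl "\<odot>" 70)
  assumes add_closed: "x \<in> S \<Longrightarrow> y \<in> S \<Longrightarrow> x \<oplus> y \<in> S"
    and mul_closed: "x \<in> S \<Longrightarrow> y \<in> S \<Longrightarrow> x \<odot> y \<in> S"
    and add_assoc: "x \<in> S \<Longrightarrow> y \<in> S \<Longrightarrow> z \<in> S \<Longrightarrow> (x \<oplus> y) \<oplus> z = x \<oplus> (y \<oplus> z)"
    and add_commute: "x \<in> S \<Longrightarrow> y \<in> S \<Longrightarrow> x \<oplus> y = y \<oplus> x"
    and add_idem: "x \<in> S \<Longrightarrow> x \<oplus> x = x"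
    and mul_assoc: "x \<in> S \<Longrightarrow> y \<in> S \<Longrightarrow> z \<in> S \<Longrightarrow> (x \<odot> y) \<odot> z = x \<odot> (y \<odot> z)"
    and distrib_left: "x \<in> S \<Longrightarrow> y \<in> S \<Longrightarrow> z \<in> S \<Longrightarrow> x \<odot> (y \<oplus> z) = x \<odot> y \<oplus> x \<odot> z"
    and distrib_right: "x \<in> S \<Longrightarrow> y \<in> S \<Longrightarrow> z \<in> S \<Longrightarrow> (x \<oplus> y) \<odot> z = x \<odot> z \<oplus> y \<odot> z"

definition semiring_le :: "('a \<Rightarrow> 'a \<Rightarrow> 'a) \<Rightarrow> 'a \<Rightarrow> 'a \<Rightarrow> bool" where
  "semiring_le add x y \<longleftrightarrow> add x y = y"

definition interval :: "'a set \<Rightarrow> ('a \<Rightarrow> 'a \<Rightarrow> 'a) \<Rightarrow> 'a \<Rightarrow> 'a \<Rightarrow> 'a set" where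
  "interval S add a b = {t \<in> S. semiring_le add a t \<and> semiring_le add t b}"

definition intervals :: "'a set \<Rightarrow> ('a \<Rightarrow> 'a \<Rightarrow> 'a) \<Rightarrow> 'a set set" where
  "intervals S add = {interval S add a b | a b. a \<in> S \<and> b \<in> S \<and> semiring_le add a b}"

definition setwise :: "('a \<Rightarrow> 'a \<Rightarrow> 'a) \<Rightarrow> 'a set \<Rightarrow> 'a set \<Rightarrow> 'a set" where
  "setwise star X Y = {star x y | x y. x \<in> X \<and> y \<in> Y}"

definition is_smallest_interval :: "'a set \<Rightarrow> ('a \<Rightarrow> 'a \<Rightarrow> 'a) \<Rightarrow> 'a set \<Rightarrow> 'a set \<Rightarrow> bool" where
  "is_smallest_interval S add A Z \<longleftrightarrow>
     Z \<in> intervals S add \<and> A \<subseteq> Z \<and> (\<forall>W \<in> intervals S add. A \<subseteq> W \<longrightarrow> Z \<subseteq> W)"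

text \<open>
  A smallest interval is unique if it exists; if there is none, the value below is unspecified.
\<close>

definition interval_op ::
  "'a set \<Rightarrow> ('a \<Rightarrow> 'a \<Rightarrow> 'a) \<Rightarrow> ('a \<Rightarrow> 'a \<Rightarrow> 'a) \<Rightarrow> 'a set \<Rightarrow> 'a set \<Rightarrow> 'a set" where
  "interval_op S add star X Y = (THE Z. is_smallest_interval S add (setwise star X Y) Z)"

end

theory Submission
  imports Defs
begin

text \<open>
  Both operations are monotone in each argument, so every element of \<open>x \<star> y\<close> lies between the two
  products of endpoints. These products themselves belong to \<open>x \<star> y\<close>, so an interval containing
  \<open>x \<star> y\<close> contains everything between them. The semiring laws for intervals then hold
  endpointwise.
\<close>

context idempotent_semiring
begin

abbreviation le (infix "\<preceq>" 50) where "x \<preceq> y \<equiv> semiring_le (\<oplus>) x y"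

lemma le_refl: "x \<in> S \<Longrightarrow> x \<preceq> x"
  by (simp add: semiring_le_def add_idem)

lemma le_trans:
  assumes "x \<in> S" "y \<in> S" "z \<in> S" "x \<preceq> y" "y \<preceq> z"
  shows "x \<preceq> z"
  using assms add_assoc[of x y z] by (simp add: semiring_le_def)

text \<open>Swapping the two middle summands of
  \<open>(a \<oplus> c) \<oplus> (b \<oplus> d)\<close> puts \<open>a\<close> next to
  \<open>b\<close> and \<open>c\<close> next to \<open>d\<close>, where the hypotheses absorb
  them.\<close>

lemma add_mono_le:
  assumes "a \<in> S" "b \<in> S" "c \<in> S" "d \<in> S" "a \<preceq> b" "c \<preceq> d"
  shows "a \<oplus> c \<preceq> b \<oplus> d"
proof -
  have "(a \<oplus> c) \<oplus> (b \<oplus> d) = a \<oplus> ((c \<oplus> b) \<oplus> d)"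
    using assms by (simp add: add_assoc add_closed)
  also have "\<dots> = a \<oplus> ((b \<oplus> c) \<oplus> d)"
    using assms by (simp add: add_commute[of c b])
  also have "\<dots> = (a \<oplus> b) \<oplus> (c \<oplus> d)"
    using assms by (simp add: add_assoc add_closed)
  finally show ?thesis
    using assms by (simp add: semiring_le_def)
qed

text \<open>Multiplying \<open>a \<oplus> b = b\<close> on the right by \<open>c\<close>, and
  \<open>c \<oplus> d = d\<close> on the left by \<open>b\<close>, changes one factor at a time. As
  \<open>\<odot>\<close> need not commute, each step has its own distributive law.\<close>

lemma mul_mono_le:
  assumes "a \<in> S" "b \<in> S" "c \<in> S" "d \<in> S" "a \<preceq> b" "c \<preceq> d"
  shows "a \<odot> c \<preceq> b \<odot> d"
proof (rule le_trans)
  show "a \<odot> c \<preceq> b \<odot> c"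
    using assms distrib_right[of a b c] by (simp add: semiring_le_def)
  show "b \<odot> c \<preceq> b \<odot> d"
    using assms distrib_left[of b c d] by (simp add: semiring_le_def)
qed (use assms in \<open>simp_all add: mul_closed\<close>)

text \<open>With \<open>star\<close> ranging over both operations, this lemma and
  \<open>star_mono\<close> let the smallest interval be found once for \<open>\<oplus>\<close> and
  \<open>\<odot>\<close> together.\<close>

lemma star_closed:
  "\<lbrakk>star \<in> {(\<oplus>), (\<odot>)}; a \<in> S; b \<in> S\<rbrakk> \<Longrightarrow> star a b \<in> S"
  by (auto simp: add_closed mul_closed)

lemma star_mono:
  "\<lbrakk>star \<in> {(\<oplus>), (\<odot>)}; a \<in> S; b \<in> S; c \<in> S; d \<in> S; a \<preceq> b; c \<preceq> d\<rbrakk>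
    \<Longrightarrow> star a c \<preceq> star b d"
  by (auto simp: add_mono_le mul_mono_le)

lemma interval_in_intervals:
  "\<lbrakk>a \<in> S; b \<in> S; a \<preceq> b\<rbrakk> \<Longrightarrow> interval S (\<oplus>) a b \<in> intervals S (\<oplus>)"
  by (auto simp: intervals_def)

lemma intervalsE:
  assumes "X \<in> intervals S (\<oplus>)"
  obtains a b where "X = interval S (\<oplus>) a b" "a \<in> S" "b \<in> S" "a \<preceq> b"
  using assms by (auto simp: intervals_def)

text \<open>Intervals are order-convex: if \<open>W\<close> has endpoints \<open>p\<close> and
  \<open>q\<close>, then \<open>p \<preceq> a \<preceq> t \<preceq> b \<preceq> q\<close> for each
  \<open>t\<close> between \<open>a\<close> and \<open>b\<close>. This yields minimality
  below.\<close>

lemma interval_subset: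
  assumes "W \<in> intervals S (\<oplus>)" "a \<in> W" "b \<in> W"
  shows "interval S (\<oplus>) a b \<subseteq> W"
proof -
  obtain p q where W: "W = interval S (\<oplus>) p q" and "p \<in> S" "q \<in> S"
    using assms(1) by (rule intervalsE)
  then show ?thesis
    using assms(2,3) le_trans unfolding interval_def by blast
qed

lemma is_smallest_interval_setwise:
  assumes star: "star \<in> {(\<oplus>), (\<odot>)}"
    and S: "a \<in> S" "b \<in> S" "c \<in> S" "d \<in> S" and le: "a \<preceq> b" "c \<preceq> d"
  shows "is_smallest_interval S (\<oplus>)
           (setwise star (interval S (\<oplus>) a b) (interval S (\<oplus>) c d))
           (interval S (\<oplus>) (star a c) (star b d))"
proof -
  let ?A = "setwise star (interval S (\<oplus>) a b) (interval S (\<oplus>) c d)"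
  have "interval S (\<oplus>) (star a c) (star b d) \<in> intervals S (\<oplus>)"
    using S le by (intro interval_in_intervals star_closed[OF star] star_mono[OF star])
  moreover have "?A \<subseteq> interval S (\<oplus>) (star a c) (star b d)"
    using star S
    unfolding setwise_def interval_def using star_closed[OF star] star_mono[OF star] by blast
  \<comment> \<open>By reflexivity and \<open>le\<close>, each interval contains its own endpoints.
    So every interval containing \<open>?A\<close> contains these two elements, and
    \<open>interval_subset\<close> applies.\<close>
  moreover have "star a c \<in> ?A" "star b d \<in> ?A"
    using S le le_refl unfolding setwise_def interval_def by blast+
  ultimately show ?thesis
    unfolding is_smallest_interval_def by (intro conjI ballI impI interval_subset) auto
qed

lemma interval_op_interval:
  assumes "star \<in> {(\<oplus>), (\<odot>)}" "a \<in> S" "b \<in> S" "c \<in> S" "d \<in> S" "a \<preceq> b" "c \<preceq> d"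
  shows "interval_op S (\<oplus>) star (interval S (\<oplus>) a b) (interval S (\<oplus>) c d)
           = interval S (\<oplus>) (star a c) (star b d)"
  unfolding interval_op_def
proof (rule the_equality)
  note smallest = is_smallest_interval_setwise[OF assms]
  show "is_smallest_interval S (\<oplus>)
           (setwise star (interval S (\<oplus>) a b) (interval S (\<oplus>) c d))
           (interval S (\<oplus>) (star a c) (star b d))"
    by (fact smallest)
  \<comment> \<open>Two smallest intervals include each other, so \<open>THE\<close> has a unique
    candidate.\<close>
  show "Z = interval S (\<oplus>) (star a c) (star b d)"
    if "is_smallest_interval S (\<oplus>)
          (setwise star (interval S (\<oplus>) a b) (interval S (\<oplus>) c d)) Z" for Z
    using that smallest unfolding is_smallest_interval_def by blast
qed

lemma idempotent_semiring_intervals: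
  "idempotent_semiring (intervals S (\<oplus>))
     (interval_op S (\<oplus>) (\<oplus>)) (interval_op S (\<oplus>) (\<odot>))"
proof
  \<comment> \<open>The equation \<open>interval_op_interval\<close> is conditional. In nested
    operations its premises concern computed endpoints, so the closure and monotonicity facts must
    accompany it.\<close>
  note endpointwise =
    interval_op_interval add_closed mul_closed add_mono_le mul_mono_le interval_in_intervals
  fix X Y assume X: "X \<in> intervals S (\<oplus>)" and Y: "Y \<in> intervals S (\<oplus>)"
  show "interval_op S (\<oplus>) (\<oplus>) X Y \<in> intervals S (\<oplus>)"
    using X Y by (auto elim!: intervalsE simp: endpointwise)
  show "interval_op S (\<oplus>) (\<odot>) X Y \<in> intervals S (\<oplus>)"
    using X Y by (auto elim!: intervalsE simp: endpointwise)
  show "interval_op S (\<oplus>) (\<oplus>) X Y = interval_op S (\<oplus>) (\<oplus>) Y X"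
    using X Y by (auto elim!: intervalsE simp: endpointwise add_commute)
  show "interval_op S (\<oplus>) (\<oplus>) X X = X"
    using X by (auto elim!: intervalsE simp: endpointwise add_idem)
  fix Z assume Z: "Z \<in> intervals S (\<oplus>)"
  show "interval_op S (\<oplus>) (\<oplus>) (interval_op S (\<oplus>) (\<oplus>) X Y) Z
      = interval_op S (\<oplus>) (\<oplus>) X (interval_op S (\<oplus>) (\<oplus>) Y Z)"
    using X Y Z by (auto elim!: intervalsE simp: endpointwise add_assoc)
  show "interval_op S (\<oplus>) (\<odot>) (interval_op S (\<oplus>) (\<odot>) X Y) Z
      = interval_op S (\<oplus>) (\<odot>) X (interval_op S (\<oplus>) (\<odot>) Y Z)"
    using X Y Z by (auto elim!: intervalsE simp: endpointwise mul_assoc)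
  show "interval_op S (\<oplus>) (\<odot>) X (interval_op S (\<oplus>) (\<oplus>) Y Z)
      = interval_op S (\<oplus>) (\<oplus>) (interval_op S (\<oplus>) (\<odot>) X Y)
          (interval_op S (\<oplus>) (\<odot>) X Z)"
    using X Y Z by (auto elim!: intervalsE simp: endpointwise distrib_left)
  show "interval_op S (\<oplus>) (\<odot>) (interval_op S (\<oplus>) (\<oplus>) X Y) Z
      = interval_op S (\<oplus>) (\<oplus>) (interval_op S (\<oplus>) (\<odot>) X Z)
          (interval_op S (\<oplus>) (\<odot>) Y Z)"
    using X Y Z by (auto elim!: intervalsE simp: endpointwise distrib_right)
qed

end

theorem proposition2:
  fixes S :: "'a set" and add mul :: "'a \<Rightarrow> 'a \<Rightarrow> 'a"
  assumes "idempotent_semiring S add mul"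
  shows "(\<forall>star \<in> {add, mul}. \<forall>X \<in> intervals S add. \<forall>Y \<in> intervals S add.
            \<exists>Z. is_smallest_interval S add (setwise star X Y) Z)
       \<and> idempotent_semiring (intervals S add) (interval_op S add add) (interval_op S add mul)
       \<and> (\<forall>star \<in> {add, mul}. \<forall>a \<in> S. \<forall>b \<in> S. \<forall>c \<in> S. \<forall>d \<in> S.
            semiring_le add a b \<longrightarrow> semiring_le add c d \<longrightarrow>
            semiring_le add (star a c) (star b d) \<and>
            interval_op S add star (interval S add a b) (interval S add c d)
              = interval S add (star a c) (star b d))"
proof -
  interpret idempotent_semiring S add mul by (fact assms)
  show ?thesis
  proof (intro conjI ballI impI)
    fix star X Y
    assume "star \<in> {add, mul}" "X \<in> intervals S add" "Y \<in> intervals S add"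
    \<comment> \<open>The witness stays schematic until the last rule fixes it as the interval
      between the combined endpoints.\<close>
    then show "\<exists>Z. is_smallest_interval S add (setwise star X Y) Z"
      by (elim intervalsE) (hypsubst, rule exI, rule is_smallest_interval_setwise)
  next
    show "idempotent_semiring (intervals S add) (interval_op S add add) (interval_op S add mul)"
      by (fact idempotent_semiring_intervals)
  \<comment> \<open>Two goals remain, the order of the new endpoints and the formula for
    \<open>interval_op\<close>; each matches exactly one of the rules.\<close>
  qed (rule star_mono interval_op_interval; assumption)+
qed

end
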